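(* Let $G$ be a connected graph and let $k\ge 4$. If $G$ is $(k,1)$-chordal, then every minimal vertex separator in $G$ has diameter less than $\frac{k}{2}$.
   Context: Every edge of the connected graph $G$ has length $1$, interior points of edges are points of $G$, and $d$ is the induced shortest-path (length) metric on $G$; $V(G)$ is the vertex set. Diameters are taken with respect to $d$. Paths are finite and simple (distinct vertices). A cycle is a simple closed curve, given by a sequence of vertices all different except that the first and last coincide. $L(\cdot)$ denotes length. For a cycle $C$, $d_C$ denotes the length metric on $C$. A shortcut in $C$ is a path $\sigma$ in $G$ joining two vertices $p,q$ of $C$ with $L(\sigma)<d_C(p,q)$. The graph $G$ is $(k,m)$-chordal if for every cycle $C$ in $G$ with $L(C)\ge k$ there is a shortcut $\sigma$ of $C$ with $L(\sigma)\le m$. It is always assumed that $k\ge 4$ and $k\ge 2m$. A set $S\subset V(G)$ is an $ab$-separator (for vertices $a,b$) if $a$ and $b$ lie in different connected components of $G\setminus S$. It is a minimal $ab$-separator if no proper subset of $S$ separates $a$ and $b$. $S$ is a minimal vertex separator if it is a minimal $ab$-separator for some pair of vertices $a,b$. *)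

theory Defs
  imports "HOL-Library.Extended_Real"
begin

text \<open>
  Graphs are simple and undirected, given by a possibly infinite vertex set \<open>V\<close> and a set \<open>E\<close> of
  two-element subsets of \<open>V\<close>. Every edge has length 1; points in the interior of edges
  are not represented, since all the notions below only measure distances between vertices.
\<close>

definition simple_graph :: "'a set \<Rightarrow> 'a set set \<Rightarrow> bool" where
  "simple_graph V E \<longleftrightarrow> (\<forall>e\<in>E. e \<subseteq> V \<and> card e = 2)"

definition path_in :: "'a set \<Rightarrow> 'a set set \<Rightarrow> 'a list \<Rightarrow> bool" where
  "path_in V E p \<longleftrightarrow>
     p \<noteq> [] \<and> set p \<subseteq> V \<and> distinct p \<and> successively (\<lambda>u v. {u, v} \<in> E) p"

text \<open>The number of edges, both for paths and for cycles (listed with the base vertex repeated).\<close>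

definition len :: "'a list \<Rightarrow> nat" where
  "len p = length p - 1"

definition paths_joining :: "'a set \<Rightarrow> 'a set set \<Rightarrow> 'a \<Rightarrow> 'a \<Rightarrow> 'a list set" where
  "paths_joining V E u v = {p. path_in V E p \<and> hd p = u \<and> last p = v}"

definition connected_graph :: "'a set \<Rightarrow> 'a set set \<Rightarrow> bool" where
  "connected_graph V E \<longleftrightarrow> (\<forall>u\<in>V. \<forall>v\<in>V. paths_joining V E u v \<noteq> {})"

text \<open>The length metric, restricted to vertices; its value is \<open>\<infinity>\<close> if no path joins \<open>u\<close> and \<open>v\<close>.\<close>

definition gdist :: "'a set \<Rightarrow> 'a set set \<Rightarrow> 'a \<Rightarrow> 'a \<Rightarrow> enat" where
  "gdist V E u v = (INF p\<in>paths_joining V E u v. enat (len p))"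

text \<open>Extended-valued, so that an unbounded set has diameter \<open>\<infinity>\<close>.\<close>

definition gdiameter :: "'a set \<Rightarrow> 'a set set \<Rightarrow> 'a set \<Rightarrow> enat" where
  "gdiameter V E S = (SUP u\<in>S. SUP v\<in>S. gdist V E u v)"

text \<open>
  A cycle is the list of its vertices with the first one repeated at the end. Requiring at least
  three edges excludes an edge traversed back and forth, which is not a simple closed curve.
\<close>

definition cycle_in :: "'a set \<Rightarrow> 'a set set \<Rightarrow> 'a list \<Rightarrow> bool" where
  "cycle_in V E c \<longleftrightarrow>
     len c \<ge> 3 \<and> set c \<subseteq> V \<and> hd c = last c \<and> distinct (tl c)
     \<and> successively (\<lambda>u v. {u, v} \<in> E) c"

definition cycle_edges :: "'a list \<Rightarrow> 'a set set" where
  "cycle_edges c = {{c ! i, c ! Suc i} | i. Suc i < length c}"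

text \<open>
  The length metric \<open>d\<^sub>C\<close> of a cycle \<open>C\<close> is the length metric of \<open>C\<close> regarded as a graph of its own.
\<close>

definition cycle_dist :: "'a list \<Rightarrow> 'a \<Rightarrow> 'a \<Rightarrow> enat" where
  "cycle_dist c = gdist (set c) (cycle_edges c)"

definition is_shortcut :: "'a set \<Rightarrow> 'a set set \<Rightarrow> 'a list \<Rightarrow> 'a list \<Rightarrow> bool" where
  "is_shortcut V E c s \<longleftrightarrow>
     (\<exists>p\<in>set c. \<exists>q\<in>set c. s \<in> paths_joining V E p q \<and> enat (len s) < cycle_dist c p q)"

definition chordal :: "real \<Rightarrow> real \<Rightarrow> 'a set \<Rightarrow> 'a set set \<Rightarrow> bool" where
  "chordal k m V E \<longleftrightarrow>
     (\<forall>c. cycle_in V E c \<and> real (len c) \<ge> k \<longrightarrow> (\<exists>s. is_shortcut V E c s \<and> real (len s) \<le> m))"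

definition component :: "'a set \<Rightarrow> 'a set set \<Rightarrow> 'a \<Rightarrow> 'a set" where
  "component V E a = {v. paths_joining V E a v \<noteq> {}}"

text \<open>
  Removing \<open>S\<close> from the metric graph leaves behind the interiors of the edges that meet \<open>S\<close>. They do
  not connect any remaining vertices, so these edges can be deleted altogether.
\<close>

definition delete_edges :: "'a set set \<Rightarrow> 'a set \<Rightarrow> 'a set set" where
  "delete_edges E S = {e \<in> E. e \<inter> S = {}}"

definition separator :: "'a set \<Rightarrow> 'a set set \<Rightarrow> 'a \<Rightarrow> 'a \<Rightarrow> 'a set \<Rightarrow> bool" where
  "separator V E a b S \<longleftrightarrow>
     S \<subseteq> V \<and> a \<in> V - S \<and> b \<in> V - S
     \<and> component (V - S) (delete_edges E S) a \<noteq> component (V - S) (delete_edges E S) b"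

definition minimal_separator :: "'a set \<Rightarrow> 'a set set \<Rightarrow> 'a \<Rightarrow> 'a \<Rightarrow> 'a set \<Rightarrow> bool" where
  "minimal_separator V E a b S \<longleftrightarrow>
     separator V E a b S \<and> (\<forall>T. T \<subset> S \<longrightarrow> \<not> separator V E a b T)"

definition minimal_vertex_separator :: "'a set \<Rightarrow> 'a set set \<Rightarrow> 'a set \<Rightarrow> bool" where
  "minimal_vertex_separator V E S \<longleftrightarrow> (\<exists>a\<in>V. \<exists>b\<in>V. minimal_separator V E a b S)"

end

theory Submission imports Defs
begin

text \<open>
  Let \<open>S\<close> be a minimal \<open>ab\<close>-separator, and let \<open>A\<close> and \<open>B\<close> be the components of \<open>a\<close> and \<open>b\<close> in
  \<open>G - S\<close>. Minimality makes both components full: every \<open>s \<in> S\<close> lies on some path from \<open>a\<close> to \<open>b\<close>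
  that avoids the rest of \<open>S\<close>, so \<open>s\<close> has a neighbour in \<open>A\<close> and a neighbour in \<open>B\<close>
  (lemma \<open>minimal_separator_neighbours\<close>).

  Suppose that two vertices \<open>u\<close> and \<open>v\<close> of \<open>S\<close> have distance at least \<open>k / 2 \<ge> 2\<close>. Join them by a
  shortest path among those with interior in \<open>A\<close>, and by a shortest path among those with interior
  in \<open>B\<close>. Together the two paths form a cycle of length at least \<open>k\<close>. By chordality this cycle has
  a shortcut of length at most 1, that is, a chord. But a chord cannot join two vertices of the
  same path, since that path is shortest, and it cannot join an interior vertex of one path to an
  interior vertex of the other, since \<open>A\<close> and \<open>B\<close> are different components of \<open>G - S\<close>
  (lemma \<open>gdist_less_if_two_sides\<close>).

  All distances are integers, so the pointwise strict bound survives the supremum.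
\<close>

section \<open>Walks and shortest walks\<close>

text \<open>
  Walks may repeat vertices, so they can be concatenated freely, and a shortest one is
  automatically a path.
\<close>

definition walk_in :: "'a set \<Rightarrow> 'a set set \<Rightarrow> 'a \<Rightarrow> 'a \<Rightarrow> 'a list \<Rightarrow> bool" where
  "walk_in V E u v p \<longleftrightarrow>
     p \<noteq> [] \<and> hd p = u \<and> last p = v \<and> set p \<subseteq> V \<and> successively (\<lambda>x y. {x, y} \<in> E) p"

definition shortest_walk_in :: "'a set \<Rightarrow> 'a set set \<Rightarrow> 'a \<Rightarrow> 'a \<Rightarrow> 'a list \<Rightarrow> bool" where
  "shortest_walk_in V E u v p \<longleftrightarrow>
     walk_in V E u v p \<and> (\<forall>q. walk_in V E u v q \<longrightarrow> length p \<le> length q)"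

lemma paths_joining_iff: "p \<in> paths_joining V E u v \<longleftrightarrow> walk_in V E u v p \<and> distinct p"
  unfolding paths_joining_def path_in_def walk_in_def by auto

lemma walk_in_append:
  assumes "walk_in V E u v p" and "walk_in V E v w q"
  shows "walk_in V E u w (p @ tl q)"
  using assms unfolding walk_in_def
  by (cases q) (auto simp: successively_append_iff successively_Cons)

lemma walk_in_edge: "{u, v} \<in> E \<Longrightarrow> u \<in> V \<Longrightarrow> v \<in> V \<Longrightarrow> walk_in V E u v [u, v]"
  unfolding walk_in_def by simp

lemma walk_in_rev: "walk_in V E u v p \<Longrightarrow> walk_in V E v u (rev p)"
  unfolding walk_in_def by (auto simp: hd_rev last_rev insert_commute)

lemma walk_in_mono: "walk_in V E u v p \<Longrightarrow> V \<subseteq> W \<Longrightarrow> E \<subseteq> F \<Longrightarrow> walk_in W F u v p"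
  unfolding walk_in_def by (auto elim!: successively_mono)

lemma walk_in_take:
  assumes "walk_in V E u v p" and "i < length p"
  shows "walk_in V E u (p ! i) (take (Suc i) p)"
proof -
  have "successively (\<lambda>x y. {x, y} \<in> E) (take (Suc i) p @ drop (Suc i) p)"
    using assms(1) by (simp add: walk_in_def)
  then have "successively (\<lambda>x y. {x, y} \<in> E) (take (Suc i) p)"
    unfolding successively_append_iff by blast
  moreover have "last (take (Suc i) p) = p ! i"
    using assms(2) by (simp add: take_Suc_conv_app_nth)
  ultimately show ?thesis
    using assms set_take_subset[of "Suc i" p] unfolding walk_in_def by auto
qed

lemma walk_in_drop:
  assumes "walk_in V E u v p" and "i < length p"
  shows "walk_in V E (p ! i) v (drop i p)"
proof -
  have "successively (\<lambda>x y. {x, y} \<in> E) (take i p @ drop i p)"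
    using assms(1) by (simp add: walk_in_def)
  then have "successively (\<lambda>x y. {x, y} \<in> E) (drop i p)"
    unfolding successively_append_iff by blast
  then show ?thesis
    using assms set_drop_subset[of i p] unfolding walk_in_def by (auto simp: hd_drop_conv_nth)
qed

lemma shortest_walk_exists:
  assumes "walk_in V E u v p"
  obtains q where "shortest_walk_in V E u v q"
  using that ex_has_least_nat[of "walk_in V E u v" p length] assms
  unfolding shortest_walk_in_def by blast

lemma shortest_walk_distinct:
  assumes "shortest_walk_in V E u v p"
  shows "distinct p"
proof -
  have p: "walk_in V E u v p" and min: "\<And>q. walk_in V E u v q \<Longrightarrow> length p \<le> length q"
    using assms unfolding shortest_walk_in_def by auto
  have "p ! i \<noteq> p ! j" if "i < j" "j < length p" for i j
  proof
    assume eq: "p ! i = p ! j"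
    have "walk_in V E u v (take (Suc i) p @ tl (drop j p))"
      using walk_in_append[OF walk_in_take[OF p, of i], of v "drop j p"] walk_in_drop[OF p, of j]
        that eq by simp
    from min[OF this] show False using that by simp
  qed
  then show ?thesis unfolding distinct_conv_nth by (metis linorder_neqE_nat)
qed

text \<open>
  An edge between two vertices that are not consecutive would replace a longer piece of the walk.
\<close>

lemma shortest_walk_chordless:
  assumes "shortest_walk_in V E u v p"
    and "i < j" and "j < length p" and "{p ! i, p ! j} \<in> E"
  shows "j = Suc i"
proof -
  have p: "walk_in V E u v p" and min: "\<And>q. walk_in V E u v q \<Longrightarrow> length p \<le> length q"
    using assms(1) unfolding shortest_walk_in_def by auto
  have "p ! i \<in> V" "p ! j \<in> V"
    using p assms(2,3) unfolding walk_in_def by auto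
  then have "walk_in V E (p ! i) (p ! j) [p ! i, p ! j]"
    using assms(4) by (rule walk_in_edge[rotated])
  moreover have "walk_in V E u (p ! i) (take (Suc i) p)" "walk_in V E (p ! j) v (drop j p)"
    using walk_in_take[OF p] walk_in_drop[OF p] assms(2,3) by auto
  ultimately have "walk_in V E u v ((take (Suc i) p @ tl [p ! i, p ! j]) @ tl (drop j p))"
    by (blast intro: walk_in_append)
  from min[OF this] show ?thesis using assms(2,3) by simp
qed

lemma shortest_walk_is_path: "shortest_walk_in V E u v p \<Longrightarrow> p \<in> paths_joining V E u v"
  using shortest_walk_distinct[of V E u v p] by (simp add: paths_joining_iff shortest_walk_in_def)

lemma paths_joining_nonempty_iff: "paths_joining V E u v \<noteq> {} \<longleftrightarrow> (\<exists>p. walk_in V E u v p)"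
proof
  assume "\<exists>p. walk_in V E u v p"
  then obtain q where "shortest_walk_in V E u v q" by (blast elim: shortest_walk_exists)
  then have "q \<in> paths_joining V E u v" by (rule shortest_walk_is_path)
  then show "paths_joining V E u v \<noteq> {}" by blast
qed (auto simp: paths_joining_iff)

lemma gdist_le_walk:
  assumes "walk_in V E u v p"
  shows "gdist V E u v \<le> enat (len p)"
proof -
  obtain q where q: "shortest_walk_in V E u v q" using shortest_walk_exists[OF assms] .
  then have "q \<in> paths_joining V E u v" by (rule shortest_walk_is_path)
  then have "gdist V E u v \<le> enat (len q)" unfolding gdist_def by (rule INF_lower)
  also have "len q \<le> len p"
    using q assms unfolding shortest_walk_in_def len_def by (simp add: diff_le_mono)
  finally show ?thesis by simp
qed

section \<open>Components and separators\<close>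

lemma component_iff: "v \<in> component V E u \<longleftrightarrow> (\<exists>p. walk_in V E u v p)"
  unfolding component_def paths_joining_nonempty_iff by simp

lemma component_subset: "component V E u \<subseteq> V"
proof
  fix v assume "v \<in> component V E u"
  then obtain p where "walk_in V E u v p" unfolding component_iff ..
  then show "v \<in> V" unfolding walk_in_def by auto
qed

lemma component_eq:
  assumes "v \<in> component V E u"
  shows "component V E u = component V E v"
proof -
  obtain p where p: "walk_in V E u v p" using assms unfolding component_iff ..
  show ?thesis
    unfolding component_iff set_eq_iff
    using walk_in_append[OF p] walk_in_append[OF walk_in_rev[OF p]] by blast
qed

lemma component_self: "u \<in> V \<Longrightarrow> u \<in> component V E u"
  unfolding component_iff by (rule exI[of _ "[u]"]) (simp add: walk_in_def)

lemma component_closed: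
  assumes "x \<in> component V E u" and "{x, y} \<in> E" and "y \<in> V"
  shows "y \<in> component V E u"
proof -
  have "x \<in> V" using assms(1) by (rule subsetD[OF component_subset])
  then have "walk_in V E x y [x, y]" using assms(2,3) by (intro walk_in_edge)
  then have "y \<in> component V E x" unfolding component_iff ..
  then show ?thesis using component_eq[OF assms(1)] by simp
qed

text \<open>
  A walk starting in a component stays there, because each of its initial segments ends there.
\<close>

lemma component_connected:
  assumes "x \<in> component V E u" and "y \<in> component V E u"
  obtains p where "walk_in (component V E u) E x y p"
proof -
  have eq: "component V E u = component V E x" using component_eq[OF assms(1)] .
  then have "y \<in> component V E x" using assms(2) by simp
  then obtain p where p: "walk_in V E x y p" unfolding component_iff ..
  have "set p \<subseteq> component V E x"
  proof
    fix z assume "z \<in> set p"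
    then obtain i where "i < length p" "z = p ! i" by (auto simp: in_set_conv_nth)
    then show "z \<in> component V E x" using walk_in_take[OF p] unfolding component_iff by blast
  qed
  then have "walk_in (component V E u) E x y p" using p eq unfolding walk_in_def by blast
  with that show ?thesis .
qed

lemma walk_in_delete_edges:
  assumes "walk_in V E u v p" and "set p \<inter> S = {}"
  shows "walk_in (V - S) (delete_edges E S) u v p"
proof -
  have "successively (\<lambda>x y. {x, y} \<in> delete_edges E S) p"
    by (rule successively_mono[of "\<lambda>x y. {x, y} \<in> E"])
      (use assms in \<open>auto simp: walk_in_def delete_edges_def\<close>)
  then show ?thesis using assms unfolding walk_in_def by blast
qed

lemma separator_commute: "separator V E a b S \<longleftrightarrow> separator V E b a S"
  unfolding separator_def by auto

lemma minimal_separator_commute: "minimal_separator V E a b S \<longleftrightarrow> minimal_separator V E b a S"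
  unfolding minimal_separator_def separator_commute[of V E a b] ..

text \<open>
  Since \<open>S - {s}\<close> does not separate, some walk from \<open>a\<close> to \<open>b\<close> meets \<open>S\<close> in \<open>s\<close> alone. Up to
  its first visit to \<open>s\<close> it runs inside the component of \<open>a\<close>.
\<close>

lemma minimal_separator_neighbours:
  assumes "minimal_separator V E a b S" and "s \<in> S"
  obtains x where "x \<in> component (V - S) (delete_edges E S) a" and "{x, s} \<in> E"
proof -
  let ?T = "S - {s}"
  have sep: "separator V E a b S" and "\<not> separator V E a b ?T"
    using assms unfolding minimal_separator_def by auto
  then have "component (V - ?T) (delete_edges E ?T) a = component (V - ?T) (delete_edges E ?T) b"
    and b: "b \<in> V - ?T" unfolding separator_def by auto
  with component_self[OF b] have "b \<in> component (V - ?T) (delete_edges E ?T) a" by simp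
  then obtain p where p: "walk_in (V - ?T) (delete_edges E ?T) a b p" unfolding component_iff ..
  have pE: "walk_in V E a b p"
    by (rule walk_in_mono[OF p]) (auto simp: delete_edges_def)
  \<comment> \<open>Otherwise \<open>p\<close> would avoid \<open>S\<close> altogether, although \<open>S\<close> separates \<open>a\<close> from \<open>b\<close>.\<close>
  have "s \<in> set p"
  proof (rule ccontr)
    assume "s \<notin> set p"
    then have "set p \<inter> S = {}" using p unfolding walk_in_def by blast
    then have "b \<in> component (V - S) (delete_edges E S) a"
      using walk_in_delete_edges[OF pE] unfolding component_iff by blast
    from component_eq[OF this] sep show False unfolding separator_def by simp
  qed
  then obtain xs ys where split: "p = xs @ s # ys" and xs: "s \<notin> set xs"
    by (meson split_list_first)
  have "a \<noteq> s" using sep assms(2) unfolding separator_def by blast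
  then have "xs \<noteq> []" using pE split unfolding walk_in_def by auto
  with pE split have "walk_in V E a (last xs) xs" and edge: "{last xs, s} \<in> E"
    unfolding walk_in_def by (auto simp: successively_append_iff)
  moreover have "set xs \<inter> S = {}" using p split xs unfolding walk_in_def by auto
  ultimately have "walk_in (V - S) (delete_edges E S) a (last xs) xs"
    by (intro walk_in_delete_edges)
  then have "last xs \<in> component (V - S) (delete_edges E S) a" unfolding component_iff ..
  then show ?thesis using that edge by blast
qed

lemma walk_through_component:
  assumes "minimal_separator V E a b S" and "u \<in> S" and "v \<in> S"
  obtains p where "walk_in (component (V - S) (delete_edges E S) a \<union> {u, v}) E u v p"
proof -
  let ?A = "component (V - S) (delete_edges E S) a"
  obtain x where x: "x \<in> ?A" "{x, u} \<in> E"
    using minimal_separator_neighbours[OF assms(1,2)] .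
  obtain y where y: "y \<in> ?A" "{y, v} \<in> E"
    using minimal_separator_neighbours[OF assms(1,3)] .
  obtain q where q: "walk_in ?A (delete_edges E S) x y q"
    using component_connected[OF x(1) y(1)] .
  have "walk_in (?A \<union> {u, v}) E x y q"
    by (rule walk_in_mono[OF q]) (auto simp: delete_edges_def)
  moreover have "walk_in (?A \<union> {u, v}) E u x [u, x]"
    using x by (intro walk_in_edge) (auto simp: insert_commute)
  moreover have "walk_in (?A \<union> {u, v}) E y v [y, v]"
    using y by (intro walk_in_edge) auto
  ultimately have "walk_in (?A \<union> {u, v}) E u v (([u, x] @ tl q) @ tl [y, v])"
    by (blast intro: walk_in_append)
  with that show ?thesis .
qed

section \<open>Chords of a cycle\<close>

lemma cycle_dist_self: "x \<in> set c \<Longrightarrow> cycle_dist c x x = 0"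
  unfolding cycle_dist_def
  using gdist_le_walk[of "set c" "cycle_edges c" x x "[x]"]
  by (simp add: walk_in_def len_def flip: zero_enat_def)

lemma cycle_dist_edge:
  assumes "{x, y} \<in> cycle_edges c"
  shows "cycle_dist c x y \<le> 1"
proof -
  have "{x, y} \<subseteq> set c" using assms unfolding cycle_edges_def by force
  then have "walk_in (set c) (cycle_edges c) x y [x, y]" using assms by (intro walk_in_edge) auto
  from gdist_le_walk[OF this] show ?thesis
    unfolding cycle_dist_def by (simp add: len_def one_enat_def)
qed

text \<open>
  A shortcut with a single vertex would be shorter than the cycle distance 0, so a shortcut of
  length at most 1 is an edge. It is not an edge of the cycle, since then it would save nothing.
\<close>

lemma short_shortcut_is_chord:
  assumes "is_shortcut V E c s" and "len s \<le> 1"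
  obtains x y where "x \<in> set c" and "y \<in> set c" and "x \<noteq> y" and "{x, y} \<in> E"
    and "{x, y} \<notin> cycle_edges c"
proof -
  obtain x y where xy: "x \<in> set c" "y \<in> set c" and s: "s \<in> paths_joining V E x y"
    and less: "enat (len s) < cycle_dist c x y"
    using assms(1) unfolding is_shortcut_def by blast
  have "x \<noteq> y" using less cycle_dist_self[OF xy(1)] by auto
  have sw: "walk_in V E x y s" using s by (simp add: paths_joining_iff)
  have "s = [x, y]"
  proof (cases s)
    case Nil
    with sw show ?thesis by (simp add: walk_in_def)
  next
    case (Cons z t)
    with sw \<open>x \<noteq> y\<close> assms(2) show ?thesis
      by (cases t) (auto simp: walk_in_def len_def split: if_splits)
  qed
  then have "{x, y} \<in> E" and "enat (len s) = 1"
    using sw by (auto simp: walk_in_def len_def one_enat_def)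
  moreover have "{x, y} \<notin> cycle_edges c"
    using less cycle_dist_edge \<open>enat (len s) = 1\<close> by (metis leD)
  ultimately show ?thesis using that xy \<open>x \<noteq> y\<close> by blast
qed

lemma cycle_edges_append:
  assumes "Suc i < length q"
  shows "{q ! i, q ! Suc i} \<in> cycle_edges (p @ q @ r)"
  unfolding cycle_edges_def using assms
  by (auto intro!: exI[of _ "length p + i"] simp: nth_append)

text \<open>
  The walk \<open>q\<close> stands for one of the two arcs that form a cycle: an edge of the graph between two
  of its vertices joins consecutive ones, hence is not a chord of the cycle.
\<close>

lemma shortest_walk_edge_in_cycle:
  assumes "shortest_walk_in W E u v q" and "x \<in> set q" and "y \<in> set q" and "x \<noteq> y"
    and "{x, y} \<in> E"
  shows "{x, y} \<in> cycle_edges (p @ q @ r)"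
proof -
  have ordered: "{q ! i, q ! j} \<in> cycle_edges (p @ q @ r)"
    if "i < j" "j < length q" "{q ! i, q ! j} \<in> E" for i j
    using shortest_walk_chordless[OF assms(1) that] cycle_edges_append that by blast
  obtain i j where ij: "i < length q" "x = q ! i" "j < length q" "y = q ! j"
    using assms(2,3) by (metis in_set_conv_nth)
  with assms(4) have "i < j \<or> j < i" by (metis linorder_neqE_nat)
  then show ?thesis using ordered[of i j] ordered[of j i] ij assms(5) by (metis insert_commute)
qed

lemma cycle_of_two_paths:
  assumes p: "p \<in> paths_joining V E u v" and q: "q \<in> paths_joining V E v u"
    and common: "set p \<inter> set q \<subseteq> {u, v}" and long: "len p + len q \<ge> 3"
  shows "cycle_in V E (p @ tl q)" and "len (p @ tl q) = len p + len q"
proof -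
  have pw: "walk_in V E u v p" "distinct p" and qw: "walk_in V E v u q" "distinct q"
    using p q by (auto simp: paths_joining_iff)
  then obtain p' q' where pq: "p = u # p'" "q = v # q'"
    unfolding walk_in_def by (metis list.collapse)
  show len: "len (p @ tl q) = len p + len q" by (simp add: len_def pq)
  have w: "walk_in V E u u (p @ tl q)" using walk_in_append pw(1) qw(1) by metis
  have "set p' \<inter> set q' = {}" using common pw(2) qw(2) unfolding pq by auto
  then have "distinct (tl (p @ tl q))" using pw(2) qw(2) unfolding pq by auto
  then show "cycle_in V E (p @ tl q)"
    using w len long unfolding cycle_in_def walk_in_def by auto
qed

section \<open>Distances in a separator\<close>

text \<open>
  The sides \<open>A\<close> and \<open>B\<close> each contribute one arc from \<open>u\<close> to \<open>v\<close>. Both arcs are at least as long as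
  the distance of \<open>u\<close> and \<open>v\<close> in the whole graph, so a large distance makes a long cycle,
  and this cycle has no chord.
\<close>

lemma gdist_less_if_two_sides:
  fixes k :: real
  assumes "chordal k 1 V E" and "k \<ge> 4"
    and uv: "u \<in> V" "v \<in> V" "u \<noteq> v" "{u, v} \<inter> (A \<union> B) = {}"
    and sides: "A \<subseteq> V" "B \<subseteq> V" "A \<inter> B = {}"
    and no_edge: "\<And>x y. x \<in> A \<Longrightarrow> y \<in> B \<Longrightarrow> {x, y} \<notin> E"
    and walk_A: "walk_in (A \<union> {u, v}) E u v pA" and walk_B: "walk_in (B \<union> {u, v}) E v u pB"
    and far: "enat n \<le> gdist V E u v"
  shows "real n < k / 2"
proof (rule ccontr)
  assume "\<not> real n < k / 2"
  then have n: "2 * real n \<ge> k" by simp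
  obtain p where p: "shortest_walk_in (A \<union> {u, v}) E u v p"
    using shortest_walk_exists[OF walk_A] .
  obtain q where q: "shortest_walk_in (B \<union> {u, v}) E v u q"
    using shortest_walk_exists[OF walk_B] .
  have setp: "set p \<subseteq> A \<union> {u, v}" and setq: "set q \<subseteq> B \<union> {u, v}"
    using p q by (auto simp: shortest_walk_in_def walk_in_def)
  have pV: "walk_in V E u v p"
    using p uv sides by (auto simp: shortest_walk_in_def intro: walk_in_mono)
  have qV: "walk_in V E v u q"
    using q uv sides by (auto simp: shortest_walk_in_def intro: walk_in_mono)
  have "enat n \<le> enat (len p)" using far gdist_le_walk[OF pV] by (rule order_trans)
  moreover have "enat n \<le> enat (len (rev q))"
    using far gdist_le_walk[OF walk_in_rev[OF qV]] by (rule order_trans)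
  ultimately have lens: "n \<le> len p" "n \<le> len q" by (auto simp: len_def)
  let ?c = "p @ tl q"
  have ends: "u \<in> set p" "v \<in> set p" "u \<in> set q" "v \<in> set q"
    using pV qV unfolding walk_in_def by (metis hd_in_set last_in_set)+
  have c: "cycle_in V E ?c" "len ?c = len p + len q"
    using cycle_of_two_paths[of p V E u v q] pV qV shortest_walk_distinct[OF p]
      shortest_walk_distinct[OF q] setp setq sides(3) lens n assms(2)
    by (auto simp: paths_joining_iff)
  have "real (len ?c) \<ge> k" using c(2) lens n by linarith
  then obtain s where s: "is_shortcut V E ?c s" "len s \<le> 1"
    using assms(1) c(1) unfolding chordal_def by fastforce
  obtain x y where xy: "x \<in> set ?c" "y \<in> set ?c" "x \<noteq> y" "{x, y} \<in> E"
    and chord: "{x, y} \<notin> cycle_edges ?c"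
    using short_shortcut_is_chord[OF s] .
  \<comment> \<open>The shared vertex \<open>v\<close> may be counted with either arc, so each arc is a contiguous part of the cycle.\<close>
  have c_alt: "?c = butlast p @ q"
    using pV qV unfolding walk_in_def by (cases p rule: rev_cases; cases q) auto
  have not_p: "\<not> (x \<in> set p \<and> y \<in> set p)"
    using shortest_walk_edge_in_cycle[OF p _ _ xy(3,4), of "[]" "tl q"] chord by auto
  have not_q: "\<not> (x \<in> set q \<and> y \<in> set q)"
    using shortest_walk_edge_in_cycle[OF q _ _ xy(3,4), of "butlast p" "[]"] chord c_alt by auto
  have "set (tl q) \<subseteq> set q" by (cases q) auto
  then have "set ?c \<subseteq> set p \<union> set q" by auto
  with xy not_p not_q ends setp setq have "x \<in> A \<and> y \<in> B \<or> x \<in> B \<and> y \<in> A" by blast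
  then show False using no_edge xy(4) by (metis insert_commute)
qed

lemma minimal_separator_gdist:
  fixes k :: real
  assumes "chordal k 1 V E" and "k \<ge> 4" and "minimal_separator V E a b S"
    and "u \<in> S" and "v \<in> S" and "enat n \<le> gdist V E u v"
  shows "real n < k / 2"
proof -
  let ?A = "component (V - S) (delete_edges E S) a"
  let ?B = "component (V - S) (delete_edges E S) b"
  have "S \<subseteq> V" and neq: "?A \<noteq> ?B"
    using assms(3) unfolding minimal_separator_def separator_def by auto
  have disj: "?A \<inter> ?B = {}" using neq component_eq by (metis disjoint_iff)
  have sub: "?A \<subseteq> V - S" "?B \<subseteq> V - S" by (rule component_subset)+
  have no_edge: "{x, y} \<notin> E" if "x \<in> ?A" "y \<in> ?B" for x y
  proof
    assume "{x, y} \<in> E"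
    then have "{x, y} \<in> delete_edges E S" using that sub unfolding delete_edges_def by blast
    then have "y \<in> ?A" using component_closed that sub by (metis subsetD)
    with that disj show False by blast
  qed
  obtain pA where pA: "walk_in (?A \<union> {u, v}) E u v pA"
    using walk_through_component[OF assms(3,4,5)] .
  obtain pB where pB: "walk_in (?B \<union> {v, u}) E v u pB"
    using walk_through_component minimal_separator_commute assms(3,4,5) by metis
  show ?thesis
  proof (cases "u = v")
    case True
    have "gdist V E u v \<le> enat (len [u])"
      using True assms(4) \<open>S \<subseteq> V\<close> by (intro gdist_le_walk) (auto simp: walk_in_def)
    with assms(6) have "enat n \<le> enat (len [u])" by (rule order_trans)
    then show ?thesis using assms(2) by (simp add: len_def)
  next
    case False
    show ?thesis
      by (rule gdist_less_if_two_sides[OF assms(1,2), of u v ?A ?B])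
        (use False assms(4-6) \<open>S \<subseteq> V\<close> sub disj no_edge pA pB in \<open>auto simp: insert_commute\<close>)
  qed
qed

theorem proposition2p10:
  fixes V :: "'a set" and E :: "'a set set" and k :: real
  assumes "simple_graph V E"
    and "connected_graph V E"
    and "k \<ge> 4"
    and "chordal k 1 V E"
  shows "\<forall>S. minimal_vertex_separator V E S \<longrightarrow> ereal_of_enat (gdiameter V E S) < ereal (k / 2)"
proof (intro allI impI)
  fix S
  assume "minimal_vertex_separator V E S"
  then obtain a b where S: "minimal_separator V E a b S"
    unfolding minimal_vertex_separator_def by blast
  \<comment> \<open>The largest integer below \<open>k / 2\<close>. The bound \<open>k \<ge> 4\<close> keeps the argument of \<open>nat\<close> positive.\<close>
  define m where "m = nat (\<lceil>k / 2\<rceil> - 1)"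
  have m: "real m < k / 2" and below: "\<not> real (Suc m) < k / 2"
    using assms(3) unfolding m_def by linarith+
  have "gdist V E u v \<le> enat m" if "u \<in> S" "v \<in> S" for u v
  proof (rule ccontr)
    assume "\<not> gdist V E u v \<le> enat m"
    then have "enat (Suc m) \<le> gdist V E u v"
      by (simp add: Suc_ile_eq)
    from minimal_separator_gdist[OF assms(4,3) S that this] below show False by blast
  qed
  then have "gdiameter V E S \<le> enat m" unfolding gdiameter_def by (intro SUP_least)
  then have "ereal_of_enat (gdiameter V E S) \<le> ereal_of_enat (enat m)"
    by (simp only: ereal_of_enat_le_iff)
  also have "\<dots> < ereal (k / 2)" using m by simp
  finally show "ereal_of_enat (gdiameter V E S) < ereal (k / 2)" .
qed

end
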